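(* Let $(M,\varphi,\xi,\eta,g)$ be an almost contact B-metric manifold with associated B-metric $\widetilde g$, and let $D$ and $\widetilde D$ be the Schouten-van Kampen connections associated to the Levi-Civita connections $\nabla$ of $g$ and $\widetilde\nabla$ of $\widetilde g$, respectively, and adapted to $(\mathcal{H},\mathcal{V})$. Then the curvature tensors of $D$ and $\nabla$ (respectively, of $\widetilde D$ and $\widetilde\nabla$) are related, for all $x,y,z,w$, by $$R^D(x,y,z,w)=R(x,y,\varphi^2z,\varphi^2w)+\pi_1\bigl(S(x),S(y),z,w\bigr),$$ $$R^{\widetilde D}(x,y,z,w)=\widetilde R(x,y,\varphi^2z,\varphi^2w)+\widetilde\pi_1\bigl(\widetilde S(x),\widetilde S(y),z,w\bigr).$$
   Context: An almost contact B-metric manifold $(M,\varphi,\xi,\eta,g)$ is a smooth $(2n+1)$-dimensional manifold ($n\ge 1$) with an endomorphism $\varphi$ of $TM$, a vector field $\xi$, a 1-form $\eta$ and a pseudo-Riemannian metric $g$ of signature $(n+1,n)$ such that $\varphi\xi=0$, $\varphi^2=-\mathrm{Id}+\eta\otimes\xi$, $\eta\circ\varphi=0$, $\eta(\xi)=1$, and $g(\varphi x,\varphi y)=-g(x,y)+\eta(x)\eta(y)$. The associated metric is $\widetilde g(x,y)=g(x,\varphi y)+\eta(x)\eta(y)$; $(M,\varphi,\xi,\eta,\widetilde g)$ is again an almost contact B-metric manifold. Put $\mathcal{H}=\ker\eta$, $\mathcal{V}=\mathrm{span}(\xi)$, $x^h=x-\eta(x)\xi$, $x^v=\eta(x)\xi$.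 Then $D_xy=(\nabla_xy^h)^h+(\nabla_xy^v)^v$ and $\widetilde D_xy=(\widetilde\nabla_xy^h)^h+(\widetilde\nabla_xy^v)^v$. Shape operators: $S(x)=-\nabla_x\xi$, $\widetilde S(x)=-\widetilde\nabla_x\xi$ for $x\in TM$. Also $\pi_1(x,y,z,w)=g(y,z)g(x,w)-g(x,z)g(y,w)$ and $\widetilde\pi_1(x,y,z,w)=\widetilde g(y,z)\widetilde g(x,w)-\widetilde g(x,z)\widetilde g(y,w)$. The curvature tensor of a connection $\nabla$ is $R(x,y)z=\nabla_x\nabla_yz-\nabla_y\nabla_xz-\nabla_{[x,y]}z$. Denote by $R,\widetilde R,R^D,R^{\widetilde D}$ the curvature tensors of $\nabla,\widetilde\nabla,D,\widetilde D$. The $(0,4)$-tensors of $R$ and $R^D$ are formed with $g$: $R(x,y,z,w)=g(R(x,y)z,w)$, $R^D(x,y,z,w)=g(R^D(x,y)z,w)$; those of $\widetilde R$ and $R^{\widetilde D}$ are formed with $\widetilde g$. *)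

theory Defs
  imports "HOL-Analysis.Analysis" "HOL-Library.Function_Algebras"
begin

text \<open>The pointwise real vector space structure on functions makes the library notions
  \<open>span\<close> and \<open>independent\<close> available for tangent spaces, which are sets of functionals.\<close>

instantiation "fun" :: (type, real_vector) real_vector
begin

definition scaleR_fun :: "real \<Rightarrow> ('a \<Rightarrow> 'b) \<Rightarrow> 'a \<Rightarrow> 'b"
  where "scaleR_fun c f = (\<lambda>x. c *\<^sub>R f x)"

instance
  by standard (simp_all add: scaleR_fun_def fun_eq_iff scaleR_add_right scaleR_add_left)

end

text \<open>Meaningful for open \<open>U\<close>. For a differentiable map, the total derivative is of class
  \<open>C\<^sup>k\<close> if and only if all directional derivatives are, as the domain is finite-dimensional.\<close>

primrec Ck_on ::
    "nat \<Rightarrow> 'e::euclidean_space set \<Rightarrow> ('e \<Rightarrow> 'f::real_normed_vector) \<Rightarrow> bool" where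
  "Ck_on 0 U f \<longleftrightarrow> continuous_on U f"
| "Ck_on (Suc k) U f \<longleftrightarrow>
     (\<forall>x\<in>U. f differentiable (at x)) \<and> (\<forall>v. Ck_on k U (\<lambda>x. frechet_derivative f (at x) v))"

definition smooth_on ::
    "'e::euclidean_space set \<Rightarrow> ('e \<Rightarrow> 'f::real_normed_vector) \<Rightarrow> bool" where
  "smooth_on U f \<longleftrightarrow> (\<forall>k. Ck_on k U f)"

type_synonym ('a, 'e) chart = "'a set \<times> ('a \<Rightarrow> 'e)"

text \<open>The underlying space of the manifold is the whole type \<open>'a\<close> with its topology (Hausdorff
  and second countable, as soon as \<open>'a\<close> has the corresponding type classes); its dimension is
  \<open>DIM('e)\<close>. The atlas need not be maximal, since any atlas determines the smooth structure.\<close>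

definition smooth_atlas ::
    "('a::topological_space, 'e::euclidean_space) chart set \<Rightarrow> bool" where
  "smooth_atlas A \<longleftrightarrow>
     (\<Union>(U, c)\<in>A. U) = UNIV \<and>
     (\<forall>(U, c)\<in>A. open U \<and> open (c ` U) \<and> homeomorphism U (c ` U) c (inv_into U c)) \<and>
     (\<forall>(U, c)\<in>A. \<forall>(V, d)\<in>A. smooth_on (c ` (U \<inter> V)) (d \<circ> inv_into U c))"

definition smooth_functions ::
    "('a, 'e::euclidean_space) chart set \<Rightarrow> ('a \<Rightarrow> real) set" where
  "smooth_functions A = {f. \<forall>(U, c)\<in>A. smooth_on (c ` U) (f \<circ> inv_into U c)}"

type_synonym 'a tvec = "('a \<Rightarrow> real) \<Rightarrow> real"

text \<open>Tangent vectors at \<open>p\<close> are the derivations at \<open>p\<close> of the algebra of smooth functions. They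
  are set to zero on functions that are not smooth, so that two tangent vectors are equal as soon
  as they agree on smooth functions.\<close>

definition tangent_space ::
    "('a, 'e::euclidean_space) chart set \<Rightarrow> 'a \<Rightarrow> 'a tvec set" where
  "tangent_space A p = {v.
     (\<forall>f\<in>smooth_functions A. \<forall>g\<in>smooth_functions A. v (f + g) = v f + v g) \<and>
     (\<forall>f\<in>smooth_functions A. \<forall>a. v (a *\<^sub>R f) = a * v f) \<and>
     (\<forall>f\<in>smooth_functions A. \<forall>g\<in>smooth_functions A. v (f * g) = f p * v g + g p * v f) \<and>
     (\<forall>f. f \<notin> smooth_functions A \<longrightarrow> v f = 0)}"

type_synonym 'a vfield = "'a \<Rightarrow> 'a tvec"

definition deriv_along :: "'a vfield \<Rightarrow> ('a \<Rightarrow> real) \<Rightarrow> 'a \<Rightarrow> real" where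
  "deriv_along X f = (\<lambda>p. X p f)"

definition vector_fields ::
    "('a, 'e::euclidean_space) chart set \<Rightarrow> 'a vfield set" where
  "vector_fields A = {X. (\<forall>p. X p \<in> tangent_space A p) \<and>
     (\<forall>f\<in>smooth_functions A. deriv_along X f \<in> smooth_functions A)}"

definition fscale :: "('a \<Rightarrow> real) \<Rightarrow> 'a vfield \<Rightarrow> 'a vfield" where
  "fscale f X = (\<lambda>p. f p *\<^sub>R X p)"

definition lie_bracket :: "'a vfield \<Rightarrow> 'a vfield \<Rightarrow> 'a vfield" where
  "lie_bracket X Y = (\<lambda>p f. X p (deriv_along Y f) - Y p (deriv_along X f))"

definition linear_on_subspace ::
    "'v::real_vector set \<Rightarrow> ('v \<Rightarrow> 'w::real_vector) \<Rightarrow> bool" where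
  "linear_on_subspace V L \<longleftrightarrow>
     (\<forall>x\<in>V. \<forall>y\<in>V. L (x + y) = L x + L y) \<and> (\<forall>x\<in>V. \<forall>a. L (a *\<^sub>R x) = a *\<^sub>R L x)"

text \<open>A tensor field is a family of multilinear maps on the tangent spaces; it is smooth if it
  sends smooth vector fields to smooth vector fields (respectively, smooth functions).\<close>

definition one_form ::
    "('a, 'e::euclidean_space) chart set \<Rightarrow> ('a \<Rightarrow> 'a tvec \<Rightarrow> real) \<Rightarrow> bool" where
  "one_form A \<eta> \<longleftrightarrow>
     (\<forall>p. linear_on_subspace (tangent_space A p) (\<eta> p)) \<and>
     (\<forall>X\<in>vector_fields A. (\<lambda>p. \<eta> p (X p)) \<in> smooth_functions A)"

definition endomorphism_field ::
    "('a, 'e::euclidean_space) chart set \<Rightarrow> ('a \<Rightarrow> 'a tvec \<Rightarrow> 'a tvec) \<Rightarrow> bool" where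
  "endomorphism_field A \<phi> \<longleftrightarrow>
     (\<forall>p. linear_on_subspace (tangent_space A p) (\<phi> p) \<and>
          \<phi> p ` tangent_space A p \<subseteq> tangent_space A p) \<and>
     (\<forall>X\<in>vector_fields A. (\<lambda>p. \<phi> p (X p)) \<in> vector_fields A)"

text \<open>The number \<open>r\<close> of positive directions comes first.\<close>

definition has_signature ::
    "'v::real_vector set \<Rightarrow> ('v \<Rightarrow> 'v \<Rightarrow> real) \<Rightarrow> nat \<Rightarrow> nat \<Rightarrow> bool" where
  "has_signature V b r s \<longleftrightarrow>
     (\<exists>P N. finite P \<and> finite N \<and> P \<inter> N = {} \<and> card P = r \<and> card N = s \<and>
        independent (P \<union> N) \<and> span (P \<union> N) = V \<and>
        (\<forall>x\<in>P \<union> N. \<forall>y\<in>P \<union> N. x \<noteq> y \<longrightarrow> b x y = 0) \<and>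
        (\<forall>x\<in>P. b x x = 1) \<and> (\<forall>x\<in>N. b x x = - 1))"

definition pseudo_Riemannian_metric ::
    "('a, 'e::euclidean_space) chart set \<Rightarrow> nat \<Rightarrow> nat \<Rightarrow> ('a \<Rightarrow> 'a tvec \<Rightarrow> 'a tvec \<Rightarrow> real) \<Rightarrow> bool"
  where
  "pseudo_Riemannian_metric A r s g \<longleftrightarrow>
     (\<forall>p. \<forall>x\<in>tangent_space A p. linear_on_subspace (tangent_space A p) (g p x)) \<and>
     (\<forall>p. \<forall>x\<in>tangent_space A p. \<forall>y\<in>tangent_space A p. g p x y = g p y x) \<and>
     (\<forall>p. has_signature (tangent_space A p) (g p) r s) \<and>
     (\<forall>X\<in>vector_fields A. \<forall>Y\<in>vector_fields A. (\<lambda>p. g p (X p) (Y p)) \<in> smooth_functions A)"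

type_synonym 'a conn = "'a vfield \<Rightarrow> 'a vfield \<Rightarrow> 'a vfield"

definition affine_connection ::
    "('a, 'e::euclidean_space) chart set \<Rightarrow> 'a conn \<Rightarrow> bool" where
  "affine_connection A D \<longleftrightarrow>
     (\<forall>X\<in>vector_fields A. \<forall>Y\<in>vector_fields A. D X Y \<in> vector_fields A) \<and>
     (\<forall>X\<in>vector_fields A. \<forall>Y\<in>vector_fields A. \<forall>Z\<in>vector_fields A.
        D (X + Y) Z = D X Z + D Y Z \<and> D X (Y + Z) = D X Y + D X Z) \<and>
     (\<forall>f\<in>smooth_functions A. \<forall>X\<in>vector_fields A. \<forall>Y\<in>vector_fields A.
        D (fscale f X) Y = fscale f (D X Y) \<and>
        D X (fscale f Y) = fscale (deriv_along X f) Y + fscale f (D X Y))"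

definition Levi_Civita_connection ::
    "('a, 'e::euclidean_space) chart set \<Rightarrow> ('a \<Rightarrow> 'a tvec \<Rightarrow> 'a tvec \<Rightarrow> real) \<Rightarrow> 'a conn \<Rightarrow> bool"
  where
  "Levi_Civita_connection A g D \<longleftrightarrow>
     affine_connection A D \<and>
     (\<forall>X\<in>vector_fields A. \<forall>Y\<in>vector_fields A. D X Y - D Y X = lie_bracket X Y) \<and>
     (\<forall>X\<in>vector_fields A. \<forall>Y\<in>vector_fields A. \<forall>Z\<in>vector_fields A.
        deriv_along X (\<lambda>p. g p (Y p) (Z p)) =
        (\<lambda>p. g p (D X Y p) (Z p) + g p (Y p) (D X Z p)))"

definition curvature :: "'a conn \<Rightarrow> 'a vfield \<Rightarrow> 'a vfield \<Rightarrow> 'a vfield \<Rightarrow> 'a vfield" where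
  "curvature D X Y Z = D X (D Y Z) - D Y (D X Z) - D (lie_bracket X Y) Z"

definition curvature4 ::
    "('a \<Rightarrow> 'a tvec \<Rightarrow> 'a tvec \<Rightarrow> real) \<Rightarrow> 'a conn \<Rightarrow>
     'a vfield \<Rightarrow> 'a vfield \<Rightarrow> 'a vfield \<Rightarrow> 'a vfield \<Rightarrow> 'a \<Rightarrow> real" where
  "curvature4 g D X Y Z W = (\<lambda>p. g p (curvature D X Y Z p) (W p))"

definition almost_contact_B_metric_manifold ::
    "nat \<Rightarrow> ('a::{t2_space,second_countable_topology}, 'e::euclidean_space) chart set \<Rightarrow>
     ('a \<Rightarrow> 'a tvec \<Rightarrow> 'a tvec) \<Rightarrow> 'a vfield \<Rightarrow> ('a \<Rightarrow> 'a tvec \<Rightarrow> real) \<Rightarrow>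
     ('a \<Rightarrow> 'a tvec \<Rightarrow> 'a tvec \<Rightarrow> real) \<Rightarrow> bool" where
  "almost_contact_B_metric_manifold n A \<phi> \<xi> \<eta> g \<longleftrightarrow>
     1 \<le> n \<and> DIM('e) = 2 * n + 1 \<and> smooth_atlas A \<and>
     endomorphism_field A \<phi> \<and> \<xi> \<in> vector_fields A \<and> one_form A \<eta> \<and>
     pseudo_Riemannian_metric A (n + 1) n g \<and>
     (\<forall>p. \<phi> p (\<xi> p) = 0 \<and> \<eta> p (\<xi> p) = 1 \<and>
        (\<forall>x\<in>tangent_space A p. \<phi> p (\<phi> p x) = - x + \<eta> p x *\<^sub>R \<xi> p \<and> \<eta> p (\<phi> p x) = 0) \<and>
        (\<forall>x\<in>tangent_space A p. \<forall>y\<in>tangent_space A p.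
           g p (\<phi> p x) (\<phi> p y) = - g p x y + \<eta> p x * \<eta> p y))"

definition associated_metric ::
    "('a \<Rightarrow> 'a tvec \<Rightarrow> 'a tvec) \<Rightarrow> ('a \<Rightarrow> 'a tvec \<Rightarrow> real) \<Rightarrow>
     ('a \<Rightarrow> 'a tvec \<Rightarrow> 'a tvec \<Rightarrow> real) \<Rightarrow> 'a \<Rightarrow> 'a tvec \<Rightarrow> 'a tvec \<Rightarrow> real" where
  "associated_metric \<phi> \<eta> g = (\<lambda>p x y. g p x (\<phi> p y) + \<eta> p x * \<eta> p y)"

definition horizontal_part ::
    "'a vfield \<Rightarrow> ('a \<Rightarrow> 'a tvec \<Rightarrow> real) \<Rightarrow> 'a vfield \<Rightarrow> 'a vfield" where
  "horizontal_part \<xi> \<eta> X = (\<lambda>p. X p - \<eta> p (X p) *\<^sub>R \<xi> p)"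

definition vertical_part ::
    "'a vfield \<Rightarrow> ('a \<Rightarrow> 'a tvec \<Rightarrow> real) \<Rightarrow> 'a vfield \<Rightarrow> 'a vfield" where
  "vertical_part \<xi> \<eta> X = (\<lambda>p. \<eta> p (X p) *\<^sub>R \<xi> p)"

definition Schouten_van_Kampen ::
    "'a vfield \<Rightarrow> ('a \<Rightarrow> 'a tvec \<Rightarrow> real) \<Rightarrow> 'a conn \<Rightarrow> 'a conn" where
  "Schouten_van_Kampen \<xi> \<eta> D X Y =
     horizontal_part \<xi> \<eta> (D X (horizontal_part \<xi> \<eta> Y)) +
     vertical_part \<xi> \<eta> (D X (vertical_part \<xi> \<eta> Y))"

definition shape_operator :: "'a vfield \<Rightarrow> 'a conn \<Rightarrow> 'a vfield \<Rightarrow> 'a vfield" where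
  "shape_operator \<xi> D X = - D X \<xi>"

definition endo_square ::
    "('a \<Rightarrow> 'a tvec \<Rightarrow> 'a tvec) \<Rightarrow> 'a vfield \<Rightarrow> 'a vfield" where
  "endo_square \<phi> X = (\<lambda>p. \<phi> p (\<phi> p (X p)))"

definition pi1 ::
    "('a \<Rightarrow> 'a tvec \<Rightarrow> 'a tvec \<Rightarrow> real) \<Rightarrow>
     'a vfield \<Rightarrow> 'a vfield \<Rightarrow> 'a vfield \<Rightarrow> 'a vfield \<Rightarrow> 'a \<Rightarrow> real" where
  "pi1 g X Y Z W =
     (\<lambda>p. g p (Y p) (Z p) * g p (X p) (W p) - g p (X p) (Z p) * g p (Y p) (W p))"

end

theory Submission
  imports Defs
begin

text \<open>
  Both B-metrics are symmetric bilinear forms \<open>h\<close> on the tangent spaces with \<open>h(x, \<xi>) = \<eta>(x)\<close>, and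
  the two identities are one identity for such an \<open>h\<close> (\<open>curvature4_svk\<close>). Moreover \<open>\<phi>\<^sup>2\<close> is minus
  the projection \<open>x \<mapsto> x\<^sup>h\<close>, so that the two signs in \<open>R(x, y, \<phi>\<^sup>2z, \<phi>\<^sup>2w)\<close> cancel and leave
  \<open>R(x, y, z\<^sup>h, w\<^sup>h)\<close>.

  Let \<open>\<nabla>\<close> be the Levi-Civita connection of \<open>h\<close>. Differentiating \<open>h(\<xi>, \<xi>) = 1\<close> shows that
  \<open>\<nabla>\<^sub>x\<xi>\<close> is horizontal. Hence \<open>D\<^sub>x(f\<xi>) = x(f)\<xi>\<close>, and the vertical part of \<open>z\<close> contributes
  \<open>(x(yf) - y(xf) - [x, y]f)\<xi> = 0\<close> to \<open>R\<^sup>D(x, y)z\<close>. For horizontal \<open>u\<close>, \<open>D\<^sub>yu\<close> is again horizontal and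
  equals \<open>\<nabla>\<^sub>yu - \<eta>(\<nabla>\<^sub>yu)\<xi>\<close>; applying \<open>D\<^sub>x\<close> and dropping vertical terms gives
  \<open>D\<^sub>xD\<^sub>yu = (\<nabla>\<^sub>x\<nabla>\<^sub>yu)\<^sup>h - \<eta>(\<nabla>\<^sub>yu)\<nabla>\<^sub>x\<xi>\<close>, and therefore
  \<open>R\<^sup>D(x, y)u = (R(x, y)u)\<^sup>h - \<eta>(\<nabla>\<^sub>yu)\<nabla>\<^sub>x\<xi> + \<eta>(\<nabla>\<^sub>xu)\<nabla>\<^sub>y\<xi>\<close>
  (\<open>curvature_svk_horizontal\<close>). Differentiating \<open>h(u, \<xi>) = 0\<close> gives \<open>\<eta>(\<nabla>\<^sub>yu) = -h(u, \<nabla>\<^sub>y\<xi>)\<close>,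
  which turns the last two terms into \<open>\<pi>\<^sub>1\<close> of the shape operator, and the projection of
  \<open>R(x, y)u\<close> moves to \<open>w\<close> because it is self-adjoint for \<open>h\<close>.

  The calculation uses that smooth functions form an algebra containing the constants and that
  vector fields form a module over it. For derivations on an atlas these facts rest on the closure
  of \<open>Ck_on\<close> under sums and products.
\<close>

section \<open>The algebra of smooth functions\<close>

text \<open>The derivative of a sum or a product is given by the usual formula only at the points of \<open>U\<close>;
  this congruence lets it be used in the recursion for \<open>Ck_on\<close>.\<close>

lemma Ck_on_cong:
  assumes "open U" "\<And>x. x \<in> U \<Longrightarrow> f x = g x" "Ck_on k U f"
  shows "Ck_on k U g"
  using assms(2,3)
proof (induction k arbitrary: f g)
  case 0
  then show ?case by (simp cong: continuous_on_cong)
next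
  case (Suc k)
  have D: "(g has_derivative frechet_derivative f (at x)) (at x)" if "x \<in> U" for x
  proof (rule has_derivative_transform_within_open[OF _ \<open>open U\<close> that])
    show "(f has_derivative frechet_derivative f (at x)) (at x)"
      using Suc.prems(2) that by (simp add: frechet_derivative_works)
  qed (use Suc.prems in auto)
  have "frechet_derivative g (at x) = frechet_derivative f (at x)" if "x \<in> U" for x
    using frechet_derivative_at[OF D[OF that]] by simp
  then have "Ck_on k U (\<lambda>x. frechet_derivative g (at x) v)" for v
    using Suc.IH[of "\<lambda>x. frechet_derivative f (at x) v" "\<lambda>x. frechet_derivative g (at x) v"]
      Suc.prems(2) by simp
  then show ?case using D by (auto simp: differentiable_def)
qed

lemma Ck_on_Suc_imp: "Ck_on (Suc k) U f \<Longrightarrow> Ck_on k U f"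
proof (induction k arbitrary: f)
  case 0
  then show ?case
    by (auto intro!: differentiable_imp_continuous_on differentiable_at_imp_differentiable_on)
next
  case (Suc k)
  have "Ck_on (Suc k) U (\<lambda>x. frechet_derivative f (at x) v)" for v
    using Suc.prems by simp
  then show ?case using Suc.IH Suc.prems by simp
qed

lemma Ck_on_const: "Ck_on k U (\<lambda>x. c)"
  by (induction k arbitrary: c) (simp_all add: frechet_derivative_const)

lemma Ck_on_add:
  assumes "open U" "Ck_on k U f" "Ck_on k U g"
  shows "Ck_on k U (\<lambda>x. f x + g x)"
  using assms(2,3)
proof (induction k arbitrary: f g)
  case 0
  then show ?case by (simp add: continuous_on_add)
next
  case (Suc k)
  have d: "f differentiable at x" "g differentiable at x" if "x \<in> U" for x
    using Suc.prems that by auto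
  have D: "frechet_derivative (\<lambda>x. f x + g x) (at x) v =
      frechet_derivative f (at x) v + frechet_derivative g (at x) v"
    if "x \<in> U" for x v
  proof -
    have "((\<lambda>x. f x + g x) has_derivative
        (\<lambda>v. frechet_derivative f (at x) v + frechet_derivative g (at x) v)) (at x)"
      using d[OF that] by (intro has_derivative_add) (simp_all flip: frechet_derivative_works)
    from frechet_derivative_at[OF this] show ?thesis by metis
  qed
  have "Ck_on k U (\<lambda>x. frechet_derivative (\<lambda>x. f x + g x) (at x) v)" for v
  proof (rule Ck_on_cong[OF \<open>open U\<close>])
    show "Ck_on k U (\<lambda>x. frechet_derivative f (at x) v + frechet_derivative g (at x) v)"
      using Suc by simp
  qed (simp add: D)
  then show ?case using d by simp
qed

lemma Ck_on_mult:
  fixes f g :: "'e::euclidean_space \<Rightarrow> real"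
  assumes "open U" "Ck_on k U f" "Ck_on k U g"
  shows "Ck_on k U (\<lambda>x. f x * g x)"
  using assms(2,3)
proof (induction k arbitrary: f g)
  case 0
  then show ?case by (simp add: continuous_on_mult)
next
  case (Suc k)
  have d: "f differentiable at x" "g differentiable at x" if "x \<in> U" for x
    using Suc.prems that by auto
  have fg: "Ck_on k U f" "Ck_on k U g"
    using Suc.prems Ck_on_Suc_imp by blast+
  have D: "frechet_derivative (\<lambda>x. f x * g x) (at x) v =
      f x * frechet_derivative g (at x) v + frechet_derivative f (at x) v * g x"
    if "x \<in> U" for x v
  proof -
    have "((\<lambda>x. f x * g x) has_derivative
        (\<lambda>v. f x * frechet_derivative g (at x) v + frechet_derivative f (at x) v * g x)) (at x)"
      using d[OF that] by (intro has_derivative_mult) (simp_all flip: frechet_derivative_works)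
    from frechet_derivative_at[OF this] show ?thesis by metis
  qed
  have "Ck_on k U (\<lambda>x. frechet_derivative (\<lambda>x. f x * g x) (at x) v)" for v
  proof (rule Ck_on_cong[OF \<open>open U\<close>])
    show "Ck_on k U (\<lambda>x. f x * frechet_derivative g (at x) v + frechet_derivative f (at x) v * g x)"
      using Suc.prems by (intro Ck_on_add[OF \<open>open U\<close>] Suc.IH fg) simp_all
  qed (simp add: D)
  then show ?case using d by simp
qed

lemma smooth_functions_const: "(\<lambda>p. c) \<in> smooth_functions A"
  by (auto simp: smooth_functions_def smooth_on_def o_def Ck_on_const)

lemma smooth_functions_add:
  assumes "smooth_atlas A" "f \<in> smooth_functions A" "g \<in> smooth_functions A"
  shows "f + g \<in> smooth_functions A"
  using assms
  by (fastforce simp: smooth_functions_def smooth_on_def smooth_atlas_def o_def intro!: Ck_on_add)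

lemma smooth_functions_mult:
  assumes "smooth_atlas A" "f \<in> smooth_functions A" "g \<in> smooth_functions A"
  shows "f * g \<in> smooth_functions A"
  using assms
  by (fastforce simp: smooth_functions_def smooth_on_def smooth_atlas_def o_def intro!: Ck_on_mult)

section \<open>The module of vector fields\<close>

lemma tangent_space_0: "0 \<in> tangent_space A p"
  by (simp add: tangent_space_def)

lemma tangent_space_add:
  "u \<in> tangent_space A p \<Longrightarrow> v \<in> tangent_space A p \<Longrightarrow> u + v \<in> tangent_space A p"
  by (simp add: tangent_space_def algebra_simps)

lemma tangent_space_scaleR: "v \<in> tangent_space A p \<Longrightarrow> a *\<^sub>R v \<in> tangent_space A p"
  by (simp add: tangent_space_def scaleR_fun_def algebra_simps)

lemma subspace_tangent_space: "subspace (tangent_space A p)"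
  by (simp add: subspace_def tangent_space_0 tangent_space_add tangent_space_scaleR)

text \<open>The Leibniz rule for \<open>1 = 1 \<cdot> 1\<close>.\<close>

lemma tangent_const:
  assumes "v \<in> tangent_space A p"
  shows "v (\<lambda>q. c) = 0"
proof -
  let ?one = "(\<lambda>q. 1) :: 'a \<Rightarrow> real"
  have "v (?one * ?one) = v ?one + v ?one"
    using assms smooth_functions_const[of 1 A] by (auto simp: tangent_space_def)
  moreover have "?one * ?one = ?one" by (auto simp: times_fun_def)
  ultimately have "v ?one = 0" by simp
  moreover have "v (c *\<^sub>R ?one) = c * v ?one"
    using assms smooth_functions_const[of 1 A] unfolding tangent_space_def by blast
  ultimately show ?thesis by (simp add: scaleR_fun_def)
qed

lemma vector_fields_tangent: "X \<in> vector_fields A \<Longrightarrow> X p \<in> tangent_space A p"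
  by (simp add: vector_fields_def)

lemma deriv_along_smooth:
  "X \<in> vector_fields A \<Longrightarrow> f \<in> smooth_functions A \<Longrightarrow> deriv_along X f \<in> smooth_functions A"
  by (simp add: vector_fields_def)

lemma deriv_along_const: "X \<in> vector_fields A \<Longrightarrow> deriv_along X (\<lambda>p. c) = 0"
  by (simp add: deriv_along_def fun_eq_iff tangent_const[OF vector_fields_tangent])

lemma vector_fields_0: "0 \<in> vector_fields A"
  using smooth_functions_const[of 0 A]
  by (simp add: vector_fields_def tangent_space_0 deriv_along_def)

lemma vector_fields_add:
  assumes "smooth_atlas A" "X \<in> vector_fields A" "Y \<in> vector_fields A"
  shows "X + Y \<in> vector_fields A"
proof -
  have "deriv_along (X + Y) f = deriv_along X f + deriv_along Y f" for f
    by (simp add: deriv_along_def fun_eq_iff)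
  then show ?thesis
    using assms by (simp add: vector_fields_def tangent_space_add smooth_functions_add)
qed

lemma vector_fields_fscale:
  assumes "smooth_atlas A" "f \<in> smooth_functions A" "X \<in> vector_fields A"
  shows "fscale f X \<in> vector_fields A"
proof -
  have "deriv_along (fscale f X) k = f * deriv_along X k" for k
    by (simp add: deriv_along_def fscale_def scaleR_fun_def fun_eq_iff)
  then show ?thesis
    using assms
    by (simp add: vector_fields_def tangent_space_scaleR smooth_functions_mult fscale_def)
qed

lemma vector_fields_minus:
  assumes "smooth_atlas A" "X \<in> vector_fields A"
  shows "- X \<in> vector_fields A"
proof -
  have "- X = fscale (\<lambda>p. - 1) X" by (simp add: fscale_def scaleR_fun_def fun_eq_iff)
  then show ?thesis
    using vector_fields_fscale[OF assms(1) smooth_functions_const assms(2)] by simp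
qed

lemma vector_fields_diff:
  assumes "smooth_atlas A" "X \<in> vector_fields A" "Y \<in> vector_fields A"
  shows "X - Y \<in> vector_fields A"
  using vector_fields_add[OF assms(1,2) vector_fields_minus[OF assms(1,3)]] by simp

lemma linear_on_subspace_0: "linear_on_subspace V L \<Longrightarrow> subspace V \<Longrightarrow> L 0 = 0"
  using subspace_0[of V] by (auto simp: linear_on_subspace_def dest!: bspec[of _ _ 0])

lemma linear_on_subspace_simps:
  assumes "linear_on_subspace V L" "subspace V" "x \<in> V"
  shows "L (a *\<^sub>R x) = a *\<^sub>R L x" "L (- x) = - L x"
    "y \<in> V \<Longrightarrow> L (x + y) = L x + L y" "y \<in> V \<Longrightarrow> L (x - y) = L x - L y"
proof -
  have s: "L (a *\<^sub>R x) = a *\<^sub>R L x" if "x \<in> V" for a x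
    using assms that by (simp add: linear_on_subspace_def)
  have add: "L (x + y) = L x + L y" if "x \<in> V" "y \<in> V" for x y
    using assms that by (simp add: linear_on_subspace_def)
  have neg: "L (- x) = - L x" if "x \<in> V" for x
    using s[OF that, of "-1"] by simp
  show "L (x - y) = L x - L y" if "y \<in> V"
    using add[of x "- y"] neg[of y] that assms(3) subspace_neg[OF assms(2)] by simp
  show "L (a *\<^sub>R x) = a *\<^sub>R L x" "L (- x) = - L x" "y \<in> V \<Longrightarrow> L (x + y) = L x + L y"
    using assms(3) by (simp_all add: s add neg)
qed

section \<open>The Schouten-van Kampen connection of a form dual to a unit field\<close>

lemma horizontal_part_eq: "horizontal_part \<xi> \<eta> X = X - fscale (\<lambda>p. \<eta> p (X p)) \<xi>"
  by (simp add: horizontal_part_def fscale_def fun_eq_iff)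

lemma vertical_part_eq: "vertical_part \<xi> \<eta> X = fscale (\<lambda>p. \<eta> p (X p)) \<xi>"
  by (simp add: vertical_part_def fscale_def fun_eq_iff)

text \<open>The common ground of a B-metric and its associated metric, on which the curvature identity is
  proved once for both.\<close>

locale metric_dual_to_unit_field =
  fixes A :: "('a::topological_space, 'e::euclidean_space) chart set"
    and \<xi> :: "'a vfield"
    and \<eta> :: "'a \<Rightarrow> 'a tvec \<Rightarrow> real"
    and h :: "'a \<Rightarrow> 'a tvec \<Rightarrow> 'a tvec \<Rightarrow> real"
    and nabla :: "'a conn"
  assumes atlas: "smooth_atlas A"
    and xi_field: "\<xi> \<in> vector_fields A"
    and eta_form: "one_form A \<eta>"
    and eta_xi: "\<eta> p (\<xi> p) = 1"
    and h_linear: "x \<in> tangent_space A p \<Longrightarrow> linear_on_subspace (tangent_space A p) (h p x)"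
    and h_sym: "x \<in> tangent_space A p \<Longrightarrow> y \<in> tangent_space A p \<Longrightarrow> h p x y = h p y x"
    and h_xi: "x \<in> tangent_space A p \<Longrightarrow> h p x (\<xi> p) = \<eta> p x"
    and LC: "Levi_Civita_connection A h nabla"
begin

abbreviation "horiz \<equiv> horizontal_part \<xi> \<eta>"
abbreviation "svk \<equiv> Schouten_van_Kampen \<xi> \<eta> nabla"
abbreviation "eta_of X \<equiv> (\<lambda>p. \<eta> p (X p))"

lemmas tangent = vector_fields_tangent
lemmas field_add = vector_fields_add[OF atlas]
lemmas field_minus = vector_fields_minus[OF atlas]
lemmas field_diff = vector_fields_diff[OF atlas]
lemmas field_fscale = vector_fields_fscale[OF atlas]
lemmas h_simps = linear_on_subspace_simps[OF h_linear subspace_tangent_space]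

lemma eta_linear: "linear_on_subspace (tangent_space A p) (\<eta> p)"
  using eta_form by (simp add: one_form_def)

lemmas eta_0 = linear_on_subspace_0[OF eta_linear subspace_tangent_space]
lemmas eta_simps = linear_on_subspace_simps[OF eta_linear subspace_tangent_space]

lemma eta_smooth: "X \<in> vector_fields A \<Longrightarrow> eta_of X \<in> smooth_functions A"
  using eta_form by (simp add: one_form_def)

lemma nabla_field:
  "X \<in> vector_fields A \<Longrightarrow> Y \<in> vector_fields A \<Longrightarrow> nabla X Y \<in> vector_fields A"
  using LC by (simp add: Levi_Civita_connection_def affine_connection_def)

lemma nabla_add:
  "X \<in> vector_fields A \<Longrightarrow> Y \<in> vector_fields A \<Longrightarrow> Z \<in> vector_fields A \<Longrightarrow>
    nabla X (Y + Z) = nabla X Y + nabla X Z"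
  using LC by (simp add: Levi_Civita_connection_def affine_connection_def)

lemma nabla_fscale:
  "X \<in> vector_fields A \<Longrightarrow> Y \<in> vector_fields A \<Longrightarrow> f \<in> smooth_functions A \<Longrightarrow>
    nabla X (fscale f Y) = fscale (deriv_along X f) Y + fscale f (nabla X Y)"
  using LC by (simp add: Levi_Civita_connection_def affine_connection_def)

lemma nabla_metric:
  assumes "X \<in> vector_fields A" "Y \<in> vector_fields A" "Z \<in> vector_fields A"
  shows "deriv_along X (\<lambda>p. h p (Y p) (Z p)) p = h p (nabla X Y p) (Z p) + h p (Y p) (nabla X Z p)"
  using LC assms by (simp add: Levi_Civita_connection_def)

lemma nabla_0: "X \<in> vector_fields A \<Longrightarrow> nabla X 0 = 0"
  using nabla_add[of X 0 0] by (simp add: vector_fields_0)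

lemma nabla_minus:
  assumes "X \<in> vector_fields A" "Y \<in> vector_fields A"
  shows "nabla X (- Y) = - nabla X Y"
  using nabla_add[OF assms(1,2) field_minus[OF assms(2)]] nabla_0[OF assms(1)]
  by (simp add: eq_neg_iff_add_eq_0 add.commute)

lemma nabla_diff:
  assumes "X \<in> vector_fields A" "Y \<in> vector_fields A" "Z \<in> vector_fields A"
  shows "nabla X (Y - Z) = nabla X Y - nabla X Z"
  using nabla_add[OF assms(1,2) field_minus[OF assms(3)]] nabla_minus[OF assms(1,3)] by simp

text \<open>The absence of torsion, \<open>[X, Y] = \<nabla>\<^sub>XY - \<nabla>\<^sub>YX\<close>, spares a direct verification of the derivation
  property.\<close>

lemma bracket_field:
  assumes "X \<in> vector_fields A" "Y \<in> vector_fields A"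
  shows "lie_bracket X Y \<in> vector_fields A"
proof -
  have "lie_bracket X Y = nabla X Y - nabla Y X"
    using LC assms by (simp add: Levi_Civita_connection_def)
  then show ?thesis using assms by (simp add: nabla_field field_diff)
qed

lemma horiz_field: "X \<in> vector_fields A \<Longrightarrow> horiz X \<in> vector_fields A"
  unfolding horizontal_part_eq by (intro field_diff field_fscale eta_smooth xi_field)

lemma horiz_add:
  "X \<in> vector_fields A \<Longrightarrow> Y \<in> vector_fields A \<Longrightarrow> horiz (X + Y) = horiz X + horiz Y"
  by (simp add: horizontal_part_def fun_eq_iff eta_simps tangent scaleR_fun_def algebra_simps)

lemma horiz_diff:
  "X \<in> vector_fields A \<Longrightarrow> Y \<in> vector_fields A \<Longrightarrow> horiz (X - Y) = horiz X - horiz Y"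
  by (simp add: horizontal_part_def fun_eq_iff eta_simps tangent scaleR_fun_def algebra_simps)

lemma horiz_fscale:
  assumes "X \<in> vector_fields A"
  shows "horiz (fscale f X) = fscale f (horiz X)"
proof
  fix p
  show "horiz (fscale f X) p = fscale f (horiz X) p"
    using assms by (simp add: horizontal_part_def fscale_def eta_simps tangent scaleR_diff_right)
qed

lemma horiz_0: "horiz 0 = 0"
  by (simp add: horizontal_part_def fun_eq_iff eta_0 scaleR_fun_def)

lemma horiz_xi: "horiz \<xi> = 0"
  by (simp add: horizontal_part_def fun_eq_iff eta_xi scaleR_fun_def)

lemma horiz_of_horizontal: "eta_of X = 0 \<Longrightarrow> horiz X = X"
  by (simp add: horizontal_part_def fun_eq_iff scaleR_fun_def)

lemma eta_horiz: "X \<in> vector_fields A \<Longrightarrow> eta_of (horiz X) = 0"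
  by (simp add: horizontal_part_def fun_eq_iff eta_simps tangent xi_field tangent_space_scaleR
      eta_xi)

text \<open>Half the derivative of \<open>h(\<xi>, \<xi>) = 1\<close>.\<close>

lemma eta_nabla_xi:
  assumes "X \<in> vector_fields A"
  shows "eta_of (nabla X \<xi>) = 0"
proof
  fix p
  have "(\<lambda>p. h p (\<xi> p) (\<xi> p)) = (\<lambda>p. 1)"
    by (simp add: h_xi eta_xi tangent xi_field)
  then have "h p (nabla X \<xi> p) (\<xi> p) + h p (\<xi> p) (nabla X \<xi> p) = 0"
    using nabla_metric[OF assms xi_field xi_field, of p] deriv_along_const[OF assms, of 1] by simp
  moreover have "h p (\<xi> p) (nabla X \<xi> p) = h p (nabla X \<xi> p) (\<xi> p)"
    using assms by (intro h_sym tangent nabla_field xi_field)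
  ultimately show "\<eta> p (nabla X \<xi> p) = 0 p"
    using assms by (simp add: h_xi tangent nabla_field xi_field)
qed

text \<open>The derivative of \<open>h(U, \<xi>) = 0\<close>.\<close>

lemma eta_nabla_horizontal:
  assumes "X \<in> vector_fields A" "U \<in> vector_fields A" "eta_of U = 0"
  shows "\<eta> p (nabla X U p) = - h p (U p) (nabla X \<xi> p)"
proof -
  have "(\<lambda>p. h p (U p) (\<xi> p)) = (\<lambda>p. 0)"
    using assms by (simp add: h_xi tangent fun_eq_iff)
  then have "h p (nabla X U p) (\<xi> p) + h p (U p) (nabla X \<xi> p) = 0"
    using nabla_metric[OF assms(1,2) xi_field, of p] deriv_along_const[OF assms(1), of 0] by simp
  then show ?thesis using assms by (simp add: h_xi tangent nabla_field)
qed

lemma svk_horizontal: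
  assumes "X \<in> vector_fields A" "eta_of U = 0"
  shows "svk X U = horiz (nabla X U)"
proof -
  have "vertical_part \<xi> \<eta> U = 0"
    using assms(2) by (simp add: vertical_part_def fun_eq_iff scaleR_fun_def)
  then have "svk X U = horiz (nabla X U) + vertical_part \<xi> \<eta> 0"
    using assms by (simp add: Schouten_van_Kampen_def horiz_of_horizontal nabla_0)
  also have "vertical_part \<xi> \<eta> 0 = 0"
    by (simp add: vertical_part_def fun_eq_iff scaleR_fun_def eta_0)
  finally show ?thesis by simp
qed

lemma svk_vertical:
  assumes "X \<in> vector_fields A" "f \<in> smooth_functions A"
  shows "svk X (fscale f \<xi>) = fscale (deriv_along X f) \<xi>"
proof -
  have h0: "horiz (fscale f \<xi>) = 0"
    by (simp add: horiz_fscale horiz_xi xi_field) (simp add: fscale_def fun_eq_iff scaleR_fun_def)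
  have v: "vertical_part \<xi> \<eta> (fscale f \<xi>) = fscale f \<xi>"
    by (simp add: vertical_part_def fscale_def fun_eq_iff eta_simps tangent xi_field eta_xi)
  have n: "nabla X (fscale f \<xi>) = fscale (deriv_along X f) \<xi> + fscale f (nabla X \<xi>)"
    using assms by (simp add: nabla_fscale xi_field)
  have "\<eta> p (nabla X (fscale f \<xi>) p) = deriv_along X f p" for p
    unfolding n using assms fun_cong[OF eta_nabla_xi[OF assms(1)], of p]
    by (simp add: fscale_def eta_simps tangent xi_field eta_xi nabla_field tangent_space_scaleR)
  then have "vertical_part \<xi> \<eta> (nabla X (fscale f \<xi>)) = fscale (deriv_along X f) \<xi>"
    by (simp add: vertical_part_eq)
  then show ?thesis
    using assms by (simp add: Schouten_van_Kampen_def h0 v nabla_0 horiz_0)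
qed

lemma svk_add:
  assumes "X \<in> vector_fields A" "Y \<in> vector_fields A" "Z \<in> vector_fields A"
  shows "svk X (Y + Z) = svk X Y + svk X Z"
proof -
  have v_add: "vertical_part \<xi> \<eta> (Y + Z) = vertical_part \<xi> \<eta> Y + vertical_part \<xi> \<eta> Z"
    if "Y \<in> vector_fields A" "Z \<in> vector_fields A" for Y Z
    using that
    by (simp add: vertical_part_def fun_eq_iff eta_simps tangent scaleR_fun_def algebra_simps)
  have v_field: "vertical_part \<xi> \<eta> Y \<in> vector_fields A" if "Y \<in> vector_fields A" for Y
    unfolding vertical_part_eq using that by (intro field_fscale eta_smooth xi_field)
  show ?thesis
    using assms
    by (simp add: Schouten_van_Kampen_def horiz_add v_add nabla_add horiz_field v_field nabla_field
        algebra_simps)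
qed

lemma svk_field:
  assumes "X \<in> vector_fields A" "Y \<in> vector_fields A"
  shows "svk X Y \<in> vector_fields A"
  unfolding Schouten_van_Kampen_def horizontal_part_eq vertical_part_eq
  using assms
  by (intro field_add field_diff field_fscale eta_smooth nabla_field xi_field)

section \<open>Curvature of the Schouten-van Kampen connection\<close>

lemma curvature_svk_add:
  assumes "X \<in> vector_fields A" "Y \<in> vector_fields A" "Z \<in> vector_fields A" "W \<in> vector_fields A"
  shows "curvature svk X Y (Z + W) = curvature svk X Y Z + curvature svk X Y W"
  using assms by (simp add: curvature_def svk_add svk_field bracket_field)

text \<open>The vertical line bundle is flat: on \<open>f\<xi>\<close> the connection just differentiates \<open>f\<close>, and
  \<open>XYf - YXf - [X, Y]f\<close> vanishes by the definition of the bracket.\<close>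

lemma curvature_svk_vertical:
  assumes "X \<in> vector_fields A" "Y \<in> vector_fields A" "f \<in> smooth_functions A"
  shows "curvature svk X Y (fscale f \<xi>) = 0"
proof -
  have "curvature svk X Y (fscale f \<xi>) =
      fscale (deriv_along X (deriv_along Y f)) \<xi> - fscale (deriv_along Y (deriv_along X f)) \<xi> -
      fscale (deriv_along (lie_bracket X Y) f) \<xi>"
    using assms by (simp add: curvature_def svk_vertical deriv_along_smooth bracket_field)
  then show ?thesis
    by (simp add: fscale_def deriv_along_def lie_bracket_def fun_eq_iff scaleR_fun_def algebra_simps)
qed

text \<open>The term \<open>\<eta>(\<nabla>\<^sub>YU)\<nabla>\<^sub>X\<xi>\<close> appears when the vertical part of \<open>\<nabla>\<^sub>YU\<close>, which \<open>D\<close> discards, is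
  differentiated; \<open>\<nabla>\<^sub>X\<xi>\<close> being horizontal, it survives the projection.\<close>

lemma svk_svk_horizontal:
  assumes "X \<in> vector_fields A" "Y \<in> vector_fields A" "U \<in> vector_fields A" "eta_of U = 0"
  shows "svk X (svk Y U) = horiz (nabla X (nabla Y U)) - fscale (eta_of (nabla Y U)) (nabla X \<xi>)"
proof -
  let ?V = "nabla Y U"
  have V: "?V \<in> vector_fields A" and a: "eta_of ?V \<in> smooth_functions A"
    using assms by (simp_all add: nabla_field eta_smooth)
  have Xa: "deriv_along X (eta_of ?V) \<in> smooth_functions A"
    using assms a by (simp add: deriv_along_smooth)
  have f0: "fscale f 0 = 0" for f :: "'a \<Rightarrow> real"
    by (simp add: fscale_def fun_eq_iff scaleR_fun_def)
  have "nabla X (horiz ?V) = nabla X ?V -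
      (fscale (deriv_along X (eta_of ?V)) \<xi> + fscale (eta_of ?V) (nabla X \<xi>))"
    using assms V a
    by (simp add: horizontal_part_eq nabla_diff nabla_fscale field_fscale xi_field)
  then have "horiz (nabla X (horiz ?V)) = horiz (nabla X ?V) -
      (fscale (deriv_along X (eta_of ?V)) (horiz \<xi>) + fscale (eta_of ?V) (horiz (nabla X \<xi>)))"
    using assms V a Xa
    by (simp add: horiz_diff horiz_add horiz_fscale nabla_field field_fscale field_add xi_field)
  then show ?thesis
    using assms V
    by (simp add: svk_horizontal eta_horiz horiz_xi f0 horiz_of_horizontal[OF eta_nabla_xi])
qed

lemma curvature_svk_horizontal:
  assumes "X \<in> vector_fields A" "Y \<in> vector_fields A" "U \<in> vector_fields A" "eta_of U = 0"
  shows "curvature svk X Y U = horiz (curvature nabla X Y U)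
    - fscale (eta_of (nabla Y U)) (nabla X \<xi>) + fscale (eta_of (nabla X U)) (nabla Y \<xi>)"
proof -
  have "svk (lie_bracket X Y) U = horiz (nabla (lie_bracket X Y) U)"
    using assms by (simp add: svk_horizontal bracket_field)
  then show ?thesis
    unfolding curvature_def svk_svk_horizontal[OF assms]
      svk_svk_horizontal[OF assms(2,1,3,4)]
    using assms by (simp add: horiz_diff nabla_field field_diff bracket_field)
qed

lemma curvature_nabla_field:
  "X \<in> vector_fields A \<Longrightarrow> Y \<in> vector_fields A \<Longrightarrow> Z \<in> vector_fields A \<Longrightarrow>
    curvature nabla X Y Z \<in> vector_fields A"
  by (simp add: curvature_def nabla_field field_diff bracket_field)

lemma curvature_nabla_minus:
  "X \<in> vector_fields A \<Longrightarrow> Y \<in> vector_fields A \<Longrightarrow> Z \<in> vector_fields A \<Longrightarrow>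
    curvature nabla X Y (- Z) = - curvature nabla X Y Z"
  by (simp add: curvature_def nabla_field nabla_minus bracket_field)

lemma h_horiz_left:
  assumes "X \<in> vector_fields A" "Y \<in> vector_fields A"
  shows "h p (horiz X p) (Y p) = h p (X p) (Y p) - \<eta> p (X p) * \<eta> p (Y p)"
proof -
  note T = assms[THEN tangent] tangent[OF xi_field]
  have "h p (horiz X p) (Y p) = h p (Y p) (horiz X p)"
    using assms by (intro h_sym tangent horiz_field)
  also have "\<dots> = h p (Y p) (X p) - \<eta> p (X p) * \<eta> p (Y p)"
    by (simp add: horizontal_part_def h_simps T tangent_space_scaleR h_xi)
  finally show ?thesis using h_sym[OF T(1,2)] by simp
qed

text \<open>Both sides equal \<open>h(X, Y) - \<eta>(X)\<eta>(Y)\<close>.\<close>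

lemma h_horiz_swap:
  assumes "X \<in> vector_fields A" "Y \<in> vector_fields A"
  shows "h p (horiz X p) (Y p) = h p (X p) (horiz Y p)"
  using h_horiz_left[OF assms] h_horiz_left[OF assms(2,1)] assms
    h_sym[of "X p" p "Y p"] h_sym[of "X p" p "horiz Y p"]
  by (simp add: tangent horiz_field)

text \<open>Split \<open>Z\<close> into its vertical part, on which the curvature of \<open>D\<close> vanishes, and its horizontal
  part, and pair with \<open>W\<close>.\<close>

theorem curvature4_svk:
  assumes "X \<in> vector_fields A" "Y \<in> vector_fields A" "Z \<in> vector_fields A" "W \<in> vector_fields A"
  shows "curvature4 h svk X Y Z W p = curvature4 h nabla X Y (horiz Z) (horiz W) p +
    pi1 h (shape_operator \<xi> nabla X) (shape_operator \<xi> nabla Y) Z W p"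
proof -
  let ?U = "horiz Z" and ?R = "curvature nabla X Y (horiz Z)"
  have U: "?U \<in> vector_fields A" and U0: "eta_of ?U = 0"
    using assms by (simp_all add: horiz_field eta_horiz)
  have R: "?R \<in> vector_fields A"
    using assms U by (simp add: curvature_nabla_field)
  have nx: "nabla X \<xi> \<in> vector_fields A" and ny: "nabla Y \<xi> \<in> vector_fields A"
    using assms by (simp_all add: nabla_field xi_field)
  have "Z = ?U + fscale (eta_of Z) \<xi>" by (simp add: horizontal_part_eq)
  then have "curvature svk X Y Z = curvature svk X Y (?U + fscale (eta_of Z) \<xi>)"
    by (rule arg_cong)
  also have "\<dots> = curvature svk X Y ?U"
    using assms U
    by (simp add: curvature_svk_add curvature_svk_vertical field_fscale eta_smooth xi_field)
  finally have "curvature svk X Y Z = curvature svk X Y ?U" .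
  then have R_svk: "curvature svk X Y Z p = horiz ?R p
      - \<eta> p (nabla Y ?U p) *\<^sub>R nabla X \<xi> p + \<eta> p (nabla X ?U p) *\<^sub>R nabla Y \<xi> p"
    using assms U U0 by (simp add: curvature_svk_horizontal fscale_def)
  have "h p (W p) (curvature svk X Y Z p) = h p (W p) (horiz ?R p)
      - \<eta> p (nabla Y ?U p) * h p (W p) (nabla X \<xi> p)
      + \<eta> p (nabla X ?U p) * h p (W p) (nabla Y \<xi> p)"
    unfolding R_svk using assms R nx ny
    by (simp add: h_simps tangent horiz_field tangent_space_scaleR
        subspace_diff[OF subspace_tangent_space])
  moreover have "h p (W p) (horiz ?R p) = h p (?R p) (horiz W p)"
    using assms R h_horiz_swap[OF R assms(4), of p] h_sym[of "W p" p "horiz ?R p"]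
    by (simp add: tangent horiz_field)
  moreover have "curvature svk X Y Z \<in> vector_fields A"
    using assms by (simp add: curvature_def svk_field bracket_field field_diff)
  then have "h p (W p) (curvature svk X Y Z p) = h p (curvature svk X Y Z p) (W p)"
    using assms(4) by (intro h_sym tangent)
  \<comment> \<open>\<open>\<nabla>\<^sub>V\<xi>\<close> is horizontal, so \<open>h(Z\<^sup>h, \<nabla>\<^sub>V\<xi>) = h(Z, \<nabla>\<^sub>V\<xi>)\<close>.\<close>
  moreover have "\<eta> p (nabla V ?U p) = - h p (Z p) (nabla V \<xi> p)" if "V \<in> vector_fields A" for V
    using that assms U U0 fun_cong[OF eta_nabla_xi[OF that], of p]
    by (simp add: eta_nabla_horizontal h_horiz_left nabla_field xi_field)
  moreover have "h p (shape_operator \<xi> nabla V p) (B p) = - h p (B p) (nabla V \<xi> p)"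
    if "V \<in> vector_fields A" "B \<in> vector_fields A" for V B
  proof -
    have "nabla V \<xi> \<in> vector_fields A" using that by (simp add: nabla_field xi_field)
    then show ?thesis
      using that h_sym[of "- nabla V \<xi> p" p "B p"]
      by (simp add: shape_operator_def h_simps tangent subspace_neg[OF subspace_tangent_space])
  qed
  ultimately show ?thesis
    using assms(1-4) unfolding curvature4_def pi1_def by simp
qed

end

section \<open>The two B-metrics\<close>

text \<open>The duality of \<open>\<xi>\<close> and \<open>\<eta>\<close> is the compatibility of \<open>g\<close> and \<open>\<phi>\<close> at \<open>y = \<xi>\<close>, where \<open>\<phi>\<xi> = 0\<close>.\<close>

lemma B_metric_dual:
  assumes M: "almost_contact_B_metric_manifold n A \<phi> \<xi> \<eta> g"
    and LC: "Levi_Civita_connection A g nabla"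
  shows "metric_dual_to_unit_field A \<xi> \<eta> g nabla"
proof
  show "g p x (\<xi> p) = \<eta> p x" if x: "x \<in> tangent_space A p" for p x
  proof -
    have xi: "\<xi> p \<in> tangent_space A p"
      using M by (simp add: almost_contact_B_metric_manifold_def vector_fields_tangent)
    have "\<phi> p x \<in> tangent_space A p"
      using M x by (auto simp: almost_contact_B_metric_manifold_def endomorphism_field_def)
    then have "linear_on_subspace (tangent_space A p) (g p (\<phi> p x))"
      using M by (simp add: almost_contact_B_metric_manifold_def pseudo_Riemannian_metric_def)
    then have "g p (\<phi> p x) 0 = 0"
      by (rule linear_on_subspace_0[OF _ subspace_tangent_space])
    moreover have "g p (\<phi> p x) (\<phi> p (\<xi> p)) = - g p x (\<xi> p) + \<eta> p x * \<eta> p (\<xi> p)"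
      using M x xi unfolding almost_contact_B_metric_manifold_def by blast
    moreover have "\<phi> p (\<xi> p) = 0" "\<eta> p (\<xi> p) = 1"
      using M by (simp_all add: almost_contact_B_metric_manifold_def)
    ultimately show ?thesis by simp
  qed
qed (use M LC in \<open>auto simp: almost_contact_B_metric_manifold_def pseudo_Riemannian_metric_def\<close>)

text \<open>Symmetry of the associated metric says that \<open>\<phi>\<close> is self-adjoint for \<open>g\<close>, which follows by
  putting \<open>\<phi>y\<close> for \<open>y\<close> in \<open>g(\<phi>x, \<phi>y) = -g(x, y) + \<eta>(x)\<eta>(y)\<close>.\<close>

lemma associated_metric_dual:
  assumes M: "almost_contact_B_metric_manifold n A \<phi> \<xi> \<eta> g"
    and LC: "Levi_Civita_connection A g nabla"
    and LC': "Levi_Civita_connection A (associated_metric \<phi> \<eta> g) nabla'"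
  shows "metric_dual_to_unit_field A \<xi> \<eta> (associated_metric \<phi> \<eta> g) nabla'"
proof -
  interpret metric_dual_to_unit_field A \<xi> \<eta> g nabla
    using B_metric_dual[OF M LC] .
  have phi_lin: "linear_on_subspace (tangent_space A p) (\<phi> p)" for p
    using M by (simp add: almost_contact_B_metric_manifold_def endomorphism_field_def)
  have phi_T: "\<phi> p x \<in> tangent_space A p" if "x \<in> tangent_space A p" for p x
    using M that by (auto simp: almost_contact_B_metric_manifold_def endomorphism_field_def)
  have phi_xi: "\<phi> p (\<xi> p) = 0" for p
    using M by (simp add: almost_contact_B_metric_manifold_def)
  have xi_T: "\<xi> p \<in> tangent_space A p" for p
    by (simp add: tangent xi_field)
  have phi2: "\<phi> p (\<phi> p x) = - x + \<eta> p x *\<^sub>R \<xi> p" and eta_phi: "\<eta> p (\<phi> p x) = 0"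
    if "x \<in> tangent_space A p" for p x
    using M that by (simp_all add: almost_contact_B_metric_manifold_def)
  have g_phi: "g p (\<phi> p x) (\<phi> p y) = - g p x y + \<eta> p x * \<eta> p y"
    if "x \<in> tangent_space A p" "y \<in> tangent_space A p" for p x y
    using M that unfolding almost_contact_B_metric_manifold_def by blast
  have self_adjoint: "g p x (\<phi> p y) = g p y (\<phi> p x)"
    if x: "x \<in> tangent_space A p" and y: "y \<in> tangent_space A p" for p x y
  proof -
    have "- g p x (\<phi> p y) = g p (\<phi> p x) (\<phi> p (\<phi> p y))"
      using g_phi[OF x phi_T[OF y]] eta_phi[OF y] by simp
    also have "\<dots> = g p (\<phi> p x) (- y + \<eta> p y *\<^sub>R \<xi> p)"
      by (simp only: phi2[OF y])
    also have "\<dots> = - g p (\<phi> p x) y"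
      using x y by (simp add: h_simps phi_T xi_T tangent_space_scaleR h_xi eta_phi)
    finally show ?thesis using h_sym[OF y phi_T[OF x]] by simp
  qed
  show ?thesis
  proof
    show "linear_on_subspace (tangent_space A p) (associated_metric \<phi> \<eta> g p x)"
      if "x \<in> tangent_space A p" for p x
      unfolding linear_on_subspace_def associated_metric_def
      using that linear_on_subspace_simps(1,3)[OF phi_lin subspace_tangent_space, of _ p]
      by (simp add: h_simps eta_simps phi_T tangent_space_scaleR tangent_space_add algebra_simps)
    show "associated_metric \<phi> \<eta> g p x y = associated_metric \<phi> \<eta> g p y x"
      if "x \<in> tangent_space A p" "y \<in> tangent_space A p" for p x y
      using self_adjoint[OF that] by (simp add: associated_metric_def)
    show "associated_metric \<phi> \<eta> g p x (\<xi> p) = \<eta> p x" if "x \<in> tangent_space A p" for p x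
      using that linear_on_subspace_0[OF h_linear subspace_tangent_space, OF that]
      by (simp add: associated_metric_def phi_xi eta_xi)
  qed (simp_all add: atlas xi_field eta_form eta_xi LC')
qed

lemma endo_square_eq_minus_horizontal:
  assumes "almost_contact_B_metric_manifold n A \<phi> \<xi> \<eta> g" "X \<in> vector_fields A"
  shows "endo_square \<phi> X = - horizontal_part \<xi> \<eta> X"
  using assms
  by (simp add: almost_contact_B_metric_manifold_def endo_square_def horizontal_part_def fun_eq_iff
      vector_fields_tangent)

lemma (in metric_dual_to_unit_field) curvature4_svk_endo_square:
  assumes sq: "\<And>V. V \<in> vector_fields A \<Longrightarrow> endo_square \<phi> V = - horiz V"
    and F: "X \<in> vector_fields A" "Y \<in> vector_fields A" "Z \<in> vector_fields A" "W \<in> vector_fields A"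
  shows "curvature4 h svk X Y Z W p =
    curvature4 h nabla X Y (endo_square \<phi> Z) (endo_square \<phi> W) p +
    pi1 h (shape_operator \<xi> nabla X) (shape_operator \<xi> nabla Y) Z W p"
proof -
  let ?R = "curvature nabla X Y (horiz Z)"
  have T: "?R p \<in> tangent_space A p" "- ?R p \<in> tangent_space A p" "horiz W p \<in> tangent_space A p"
    "- horiz W p \<in> tangent_space A p"
    using F by (simp_all add: tangent curvature_nabla_field horiz_field
        subspace_neg[OF subspace_tangent_space])
  have "h p (- ?R p) (- horiz W p) = - h p (horiz W p) (- ?R p)"
    using T by (simp add: h_simps(2) h_sym[of "- ?R p"])
  also have "\<dots> = h p (?R p) (horiz W p)"
    using T by (simp add: h_simps(2) h_sym[of "?R p"])
  finally show ?thesis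
    using curvature4_svk[OF F]
    by (simp add: sq F curvature4_def curvature_nabla_minus
        horiz_field)
qed

theorem theorem5p1:
  fixes A :: "('a::{t2_space,second_countable_topology}, 'e::euclidean_space) chart set"
    and \<phi> :: "'a \<Rightarrow> 'a tvec \<Rightarrow> 'a tvec"
    and \<xi> :: "'a vfield"
    and \<eta> :: "'a \<Rightarrow> 'a tvec \<Rightarrow> real"
    and g g' :: "'a \<Rightarrow> 'a tvec \<Rightarrow> 'a tvec \<Rightarrow> real"
    and nabla nabla' D D' :: "'a conn"
    and n :: nat
  assumes "almost_contact_B_metric_manifold n A \<phi> \<xi> \<eta> g"
    and "g' = associated_metric \<phi> \<eta> g"
    and "Levi_Civita_connection A g nabla"
    and "Levi_Civita_connection A g' nabla'"
    and "D = Schouten_van_Kampen \<xi> \<eta> nabla"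
    and "D' = Schouten_van_Kampen \<xi> \<eta> nabla'"
  shows "\<forall>x\<in>vector_fields A. \<forall>y\<in>vector_fields A. \<forall>z\<in>vector_fields A. \<forall>w\<in>vector_fields A. \<forall>p.
      curvature4 g D x y z w p =
        curvature4 g nabla x y (endo_square \<phi> z) (endo_square \<phi> w) p +
        pi1 g (shape_operator \<xi> nabla x) (shape_operator \<xi> nabla y) z w p \<and>
      curvature4 g' D' x y z w p =
        curvature4 g' nabla' x y (endo_square \<phi> z) (endo_square \<phi> w) p +
        pi1 g' (shape_operator \<xi> nabla' x) (shape_operator \<xi> nabla' y) z w p"
proof -
  interpret G: metric_dual_to_unit_field A \<xi> \<eta> g nabla
    using B_metric_dual[OF assms(1,3)] .
  interpret G': metric_dual_to_unit_field A \<xi> \<eta> g' nabla'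
    using associated_metric_dual[OF assms(1,3)] assms(2,4) by simp
  note sq = endo_square_eq_minus_horizontal[OF assms(1)]
  show ?thesis
    unfolding assms(5,6)
    using G.curvature4_svk_endo_square[OF sq] G'.curvature4_svk_endo_square[OF sq]
    by blast
qed

end
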